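(* Let $K\ge 2$ be an integer, let $A_1,\dots,A_K\in\mathbb{R}^{N_x\times (N_z/K)}$ and $B_1,\dots,B_K\in\mathbb{R}^{(N_z/K)\times N_y}$ be fixed real matrices, and let $C=AB=\sum_{k=1}^K A_kB_k$. Let $(i_1,\dots,i_K)$ be a uniformly random permutation of $(1,\dots,K)$, let $m_l\in\{1,\dots,K\}$, and let $C_l=\sum_{k=1}^{m_l}A_{i_k}B_{i_k}$. Put $$M_1=\sum_{i=1}^K\|A_iB_i\|_F^2,\qquad M_2=\sum_{1\le i<j\le K}\operatorname{Tr}\left((A_iB_i)^T(A_jB_j)\right),$$ and assume $M_1+2\frac{m_l-1}{K-1}M_2\neq 0$. Then the solution of $\operatorname*{argmin}_{\beta\in\mathbb{R}}\mathbb{E}\left(\|C-\beta C_l\|_F^2\right)$, where the expectation is over the random permutation, is $$\beta^*=\frac{M_1+2M_2}{M_1+2\frac{(m_l-1)}{(K-1)}M_2}.$$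
   Context: $N_x,N_y,N_z$ are positive integers with $K$ dividing $N_z$. The matrix $A\in\mathbb{R}^{N_x\times N_z}$ is partitioned into $K$ equal column blocks, $A=[A_1,\dots,A_K]$, and $B\in\mathbb{R}^{N_z\times N_y}$ into $K$ equal row blocks, $B^T=[B_1^T,\dots,B_K^T]$, so that $AB=\sum_{k=1}^K A_kB_k$. $\|\cdot\|_F$ is the Frobenius norm and $\operatorname{Tr}$ the trace. *)

theory Defs
  imports
    "HOL-Probability.Probability_Mass_Function"
    "HOL-Combinatorics.Permutations"
    "Jordan_Normal_Form.Matrix"
begin

(* HOL-Analysis has constants and notation of the same names for its type-indexed
   vectors and matrices; only the matrices of Jordan_Normal_Form are used here. *)
hide_const (open) Finite_Cartesian_Product.mat Finite_Cartesian_Product.row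
  Finite_Cartesian_Product.column Determinants.trace

text \<open>Blocks are numbered from 1 to \<open>K\<close>, whereas matrix entries are numbered from 0.\<close>

definition col_block :: "nat \<Rightarrow> 'a mat \<Rightarrow> nat \<Rightarrow> 'a mat" where
  "col_block K A k = (let w = dim_col A div K in
     mat (dim_row A) w (\<lambda>(i, j). A $$ (i, (k - 1) * w + j)))"

definition row_block :: "nat \<Rightarrow> 'a mat \<Rightarrow> nat \<Rightarrow> 'a mat" where
  "row_block K B k = (let w = dim_row B div K in
     mat w (dim_col B) (\<lambda>(i, j). B $$ ((k - 1) * w + i, j)))"

definition frob_norm :: "real mat \<Rightarrow> real" where
  "frob_norm M = sqrt (\<Sum>i<dim_row M. \<Sum>j<dim_col M. (M $$ (i, j))\<^sup>2)"

definition mat_trace :: "'a::comm_monoid_add mat \<Rightarrow> 'a" where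
  "mat_trace M = (\<Sum>i<dim_row M. M $$ (i, i))"

text \<open>The matrix counterpart of \<^const>\<open>finsum_vec\<close>: the sum of a finite family of
  \<open>nr \<times> nc\<close> matrices.\<close>

definition finsum_mat ::
    "'a::monoid_add itself \<Rightarrow> nat \<Rightarrow> nat \<Rightarrow> ('c \<Rightarrow> 'a mat) \<Rightarrow> 'c set \<Rightarrow> 'a mat" where
  "finsum_mat ty nr nc = finprod (monoid_mat ty nr nc)"

lemma monoid_mat_simps:
  "mult (monoid_mat ty nr nc) = (+)"
  "one (monoid_mat ty nr nc) = 0\<^sub>m nr nc"
  "carrier (monoid_mat ty nr nc) = carrier_mat nr nc"
  by (simp_all add: monoid_mat_def)

lemmas finsum_mat_insert =
  comm_monoid.finprod_insert[OF comm_monoid_mat, folded finsum_mat_def, unfolded monoid_mat_simps]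

lemmas finsum_mat_closed =
  comm_monoid.finprod_closed[OF comm_monoid_mat, folded finsum_mat_def, unfolded monoid_mat_simps]

lemmas finsum_mat_empty =
  comm_monoid.finprod_empty[OF comm_monoid_mat, folded finsum_mat_def, unfolded monoid_mat_simps]

lemma index_finsum_mat:
  fixes M :: "'c \<Rightarrow> 'a::comm_monoid_add mat"
  assumes "finite F" and "i < nr" "j < nc" and "M \<in> F \<rightarrow> carrier_mat nr nc"
  shows "finsum_mat TYPE('a) nr nc M F $$ (i, j) = (\<Sum>f\<in>F. M f $$ (i, j))"
  using assms(1,4)
proof (induction F)
  case empty
  then show ?case using assms by (simp add: finsum_mat_empty)
next
  case (insert a F)
  have c: "M \<in> F \<rightarrow> carrier_mat nr nc" "M a \<in> carrier_mat nr nc"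
    using insert.prems by auto
  have "finsum_mat TYPE('a) nr nc M F \<in> carrier_mat nr nc"
    using finsum_mat_closed[OF c(1)] .
  then show ?case
    using finsum_mat_insert[OF insert.hyps c] insert c assms by simp
qed

lemma mult_eq_finsum_mat_blocks:
  fixes A B :: "'a::comm_semiring_0 mat"
  assumes A: "A \<in> carrier_mat nx nz" and B: "B \<in> carrier_mat nz ny" and "K dvd nz"
  shows "A * B =
    finsum_mat TYPE('a) nx ny (\<lambda>k. col_block K A k * row_block K B k) {1..K}"
    (is "_ = finsum_mat _ _ _ ?M _")
proof (rule eq_matI)
  have M: "?M \<in> {1..K} \<rightarrow> carrier_mat nx ny"
    using A B by (auto simp: col_block_def row_block_def Let_def)
  note closed = finsum_mat_closed[OF M]
  show "dim_row (A * B) = dim_row (finsum_mat TYPE('a) nx ny ?M {1..K})"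
    "dim_col (A * B) = dim_col (finsum_mat TYPE('a) nx ny ?M {1..K})"
    using closed A B by auto
  fix i j
  assume "i < dim_row (finsum_mat TYPE('a) nx ny ?M {1..K})"
    "j < dim_col (finsum_mat TYPE('a) nx ny ?M {1..K})"
  then have ij: "i < nx" "j < ny" using closed by auto
  define w where "w = nz div K"
  have nz: "nz = K * w" using assms(3) by (simp add: w_def)
  have "(A * B) $$ (i, j) = (\<Sum>l<K * w. A $$ (i, l) * B $$ (l, j))"
    using A B ij by (simp add: scalar_prod_def nz atLeast0LessThan)
  also have "\<dots> = (\<Sum>k<K. \<Sum>l\<in>{k * w..<k * w + w}. A $$ (i, l) * B $$ (l, j))"
    by (rule sum.nat_group[symmetric])
  also have "\<dots> = (\<Sum>k<K. \<Sum>l<w. A $$ (i, k * w + l) * B $$ (k * w + l, j))"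
  proof (rule sum.cong[OF refl])
    fix k
    show "(\<Sum>l\<in>{k * w..<k * w + w}. A $$ (i, l) * B $$ (l, j))
        = (\<Sum>l<w. A $$ (i, k * w + l) * B $$ (k * w + l, j))"
      using sum.shift_bounds_nat_ivl[of "\<lambda>l. A $$ (i, l) * B $$ (l, j)" 0 "k * w" w]
      by (simp add: add.commute atLeast0LessThan)
  qed
  also have "\<dots> = (\<Sum>k<K. ?M (Suc k) $$ (i, j))"
    using A B ij by (simp add: scalar_prod_def col_block_def row_block_def Let_def
        w_def[symmetric] atLeast0LessThan)
  also have "\<dots> = (\<Sum>k\<in>{1..K}. ?M k $$ (i, j))"
    by (rule sum.reindex_bij_witness[of _ "\<lambda>k. k - 1" Suc]) auto
  finally show "(A * B) $$ (i, j) = finsum_mat TYPE('a) nx ny ?M {1..K} $$ (i, j)"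
    using index_finsum_mat[OF _ ij M] by simp
qed

end

theory Submission
  imports Defs
begin

text \<open>With \<open>\<langle>\<cdot>, \<cdot>\<rangle>\<close> the Frobenius inner product, the objective expands to
  \<open>\<langle>C, C\<rangle> - 2 \<beta> \<langle>C, E C\<^sub>l\<rangle> + \<beta>\<^sup>2 E \<langle>C\<^sub>l, C\<^sub>l\<rangle>\<close>. Under a uniform permutation every
  block occurs with probability \<open>m / K\<close> and every ordered pair of distinct blocks with probability
  \<open>m (m - 1) / (K (K - 1))\<close>, so with \<open>D = M\<^sub>1 + 2 (m - 1) / (K - 1) M\<^sub>2\<close> the linear coefficient is
  \<open>-2 (m / K) (M\<^sub>1 + 2 M\<^sub>2)\<close> and the quadratic one \<open>(m / K) D\<close>. The latter is the mean of
  a squared norm, so \<open>D \<noteq> 0\<close> forces \<open>D > 0\<close>.\<close>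

section \<open>Uniformly random permutations\<close>

abbreviation unif_perm :: "'a set \<Rightarrow> ('a \<Rightarrow> 'a) pmf" where
  "unif_perm S \<equiv> pmf_of_set {\<sigma>. \<sigma> permutes S}"

lemma ex_permutes: "{\<sigma>. \<sigma> permutes S} \<noteq> {}"
  using permutes_id by blast

lemma set_unif_perm: "finite S \<Longrightarrow> set_pmf (unif_perm S) = {\<sigma>. \<sigma> permutes S}"
  by (rule set_pmf_of_set[OF ex_permutes finite_permutations])

lemma integrable_unif_perm:
  fixes f :: "('a \<Rightarrow> 'a) \<Rightarrow> real"
  assumes "finite S"
  shows "integrable (unif_perm S) f"
  using assms by (intro integrable_measure_pmf_finite) (simp add: set_unif_perm finite_permutations)

lemma expectation_unif_perm_cong:
  assumes "finite S" and "\<And>\<sigma>. \<sigma> permutes S \<Longrightarrow> f \<sigma> = g \<sigma>"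
  shows "measure_pmf.expectation (unif_perm S) f = measure_pmf.expectation (unif_perm S) g"
  using assms by (intro integral_cong_AE) (auto simp: AE_measure_pmf_iff set_unif_perm)

text \<open>Right composition with a fixed permutation is a bijection on the permutations of
  \<open>S\<close>, so it preserves the uniform law. This is the symmetry that makes all positions,
  and all pairs of distinct positions, interchangeable.\<close>

lemma expectation_unif_perm_comp:
  fixes f :: "('a \<Rightarrow> 'a) \<Rightarrow> real"
  assumes "finite S" and "\<pi> permutes S"
  shows "measure_pmf.expectation (unif_perm S) (\<lambda>\<sigma>. f (\<sigma> \<circ> \<pi>))
       = measure_pmf.expectation (unif_perm S) f"
  using assms sum_permutations_compose_right[OF assms(2), of f]
  by (simp add: integral_pmf_of_set[OF ex_permutes finite_permutations])

text \<open>By symmetry under a transposition, every position has the same mean. Adding these means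
  over all positions gives the mean of a sum that is the same for every permutation.\<close>

lemma expectation_unif_perm_at:
  fixes f :: "'a \<Rightarrow> real"
  assumes S: "finite S" and k: "k \<in> S"
  shows "card S * measure_pmf.expectation (unif_perm S) (\<lambda>\<sigma>. f (\<sigma> k)) = (\<Sum>a\<in>S. f a)"
proof -
  let ?E = "measure_pmf.expectation (unif_perm S)"
  have "?E (\<lambda>\<sigma>. f (\<sigma> k)) = ?E (\<lambda>\<sigma>. f (\<sigma> l))" if "l \<in> S" for l
    using expectation_unif_perm_comp[OF S permutes_swap_id[OF k that], of "\<lambda>\<sigma>. f (\<sigma> k)"]
    by simp
  then have "card S * ?E (\<lambda>\<sigma>. f (\<sigma> k)) = (\<Sum>l\<in>S. ?E (\<lambda>\<sigma>. f (\<sigma> l)))"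
    by (simp flip: sum_constant)
  also have "\<dots> = ?E (\<lambda>\<sigma>. \<Sum>l\<in>S. f (\<sigma> l))"
    by (simp add: integrable_unif_perm[OF S])
  also have "\<dots> = ?E (\<lambda>\<sigma>. \<Sum>a\<in>S. f a)"
    by (rule expectation_unif_perm_cong[OF S]) (metis sum.permute comp_def sum.cong)
  finally show ?thesis by simp
qed

text \<open>The same averaging, now over ordered pairs of distinct positions, any two of which are
  related by a permutation of \<open>S\<close>.\<close>

lemma expectation_unif_perm_at2:
  fixes q :: "'a \<Rightarrow> 'a \<Rightarrow> real"
  assumes S: "finite S" and kl: "k \<in> S" "l \<in> S" "k \<noteq> l"
  shows "card S * (card S - 1) * measure_pmf.expectation (unif_perm S) (\<lambda>\<sigma>. q (\<sigma> k) (\<sigma> l))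
       = (\<Sum>a\<in>S. \<Sum>b\<in>S - {a}. q a b)"
proof -
  let ?E = "measure_pmf.expectation (unif_perm S)"
  have *: "?E (\<lambda>\<sigma>. q (\<sigma> k) (\<sigma> l)) = ?E (\<lambda>\<sigma>. q (\<sigma> a) (\<sigma> b))"
    if ab: "a \<in> S" "b \<in> S - {a}" for a b
  proof -
    \<comment> \<open>The inner transposition sends \<open>k\<close> to \<open>a\<close>; the outer
      one carries the image of \<open>l\<close> to \<open>b\<close>. It leaves \<open>a\<close>
      alone, because \<open>a\<close> differs from \<open>b\<close> and, as \<open>k\<close> and
      \<open>l\<close> differ, from the image of \<open>l\<close>.\<close>
    define \<pi> where "\<pi> = Transposition.transpose (Transposition.transpose k a l) b \<circ> Transposition.transpose k a"
    have "Transposition.transpose k a l \<in> S" using ab kl by (auto simp: Transposition.transpose_def)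
    then have "\<pi> permutes S"
      unfolding \<pi>_def using ab kl by (intro permutes_compose permutes_swap_id) auto
    moreover have "\<pi> k = a" "\<pi> l = b"
      using ab kl by (auto simp: \<pi>_def Transposition.transpose_def)
    ultimately show ?thesis
      using expectation_unif_perm_comp[OF S, of \<pi> "\<lambda>\<sigma>. q (\<sigma> k) (\<sigma> l)"] by simp
  qed
  have "card S * (card S - 1) * ?E (\<lambda>\<sigma>. q (\<sigma> k) (\<sigma> l))
      = (\<Sum>a\<in>S. \<Sum>b\<in>S - {a}. ?E (\<lambda>\<sigma>. q (\<sigma> k) (\<sigma> l)))"
    using S by simp
  also have "\<dots> = (\<Sum>a\<in>S. \<Sum>b\<in>S - {a}. ?E (\<lambda>\<sigma>. q (\<sigma> a) (\<sigma> b)))"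
    using * by (intro sum.cong refl)
  also have "\<dots> = ?E (\<lambda>\<sigma>. \<Sum>a\<in>S. \<Sum>b\<in>S - {a}. q (\<sigma> a) (\<sigma> b))"
    by (simp add: integrable_unif_perm[OF S])
  also have "\<dots> = ?E (\<lambda>\<sigma>. \<Sum>a\<in>S. \<Sum>b\<in>S - {a}. q a b)"
  proof (rule expectation_unif_perm_cong[OF S])
    fix \<sigma> assume \<sigma>: "\<sigma> permutes S"
    \<comment> \<open>The excluded point moves along with the permutation, so the inner sum is
      reindexed before the outer one.\<close>
    have bij: "bij_betw \<sigma> (S - {a}) (S - {\<sigma> a})" if "a \<in> S" for a
      using permutes_inj[OF \<sigma>] permutes_image[OF \<sigma>]
      by (auto simp: bij_betw_def image_set_diff intro: inj_on_subset)
    have "(\<Sum>a\<in>S. \<Sum>b\<in>S - {a}. q (\<sigma> a) (\<sigma> b)) = (\<Sum>a\<in>S. \<Sum>b\<in>S - {\<sigma> a}. q (\<sigma> a) b)"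
      by (intro sum.cong refl sum.reindex_bij_betw bij)
    also have "\<dots> = (\<Sum>a\<in>S. \<Sum>b\<in>S - {a}. q a b)"
      by (rule sum.reindex_bij_betw[OF permutes_imp_bij[OF \<sigma>]])
    finally show "(\<Sum>a\<in>S. \<Sum>b\<in>S - {a}. q (\<sigma> a) (\<sigma> b)) = (\<Sum>a\<in>S. \<Sum>b\<in>S - {a}. q a b)" .
  qed
  finally show ?thesis by simp
qed

lemma sum_diag_offdiag:
  fixes q :: "'a \<Rightarrow> 'a \<Rightarrow> 'b::comm_monoid_add"
  assumes "finite S"
  shows "(\<Sum>a\<in>S. \<Sum>b\<in>S. q a b) = (\<Sum>a\<in>S. q a a) + (\<Sum>a\<in>S. \<Sum>b\<in>S - {a}. q a b)"
  using assms by (simp add: sum.remove flip: sum.distrib)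

text \<open>Swapping coordinates matches the pairs below the diagonal with those above it. This
  links sums over ordered pairs to the sum over \<open>i < j\<close> in
  \<open>M\<^sub>2\<close>.\<close>

lemma sum_offdiag_symmetric:
  fixes q :: "'a::linorder \<Rightarrow> 'a \<Rightarrow> real"
  assumes "finite S" and sym: "\<And>a b. q a b = q b a"
  shows "(\<Sum>a\<in>S. \<Sum>b\<in>S - {a}. q a b)
       = 2 * (\<Sum>(a, b)\<in>{(a, b). a \<in> S \<and> b \<in> S \<and> a < b}. q a b)"
proof -
  let ?U = "{(a, b). a \<in> S \<and> b \<in> S \<and> a < b}" and ?L = "{(a, b). a \<in> S \<and> b \<in> S \<and> b < a}"
  have fin: "finite ?U" "finite ?L"
    by (auto intro: finite_subset[of _ "S \<times> S"] simp: assms(1))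
  have "(\<Sum>a\<in>S. \<Sum>b\<in>S - {a}. q a b) = (\<Sum>(a, b)\<in>(SIGMA a:S. S - {a}). q a b)"
    using assms(1) by (simp add: sum.Sigma)
  also have "(SIGMA a:S. S - {a}) = ?U \<union> ?L" by auto
  also have "(\<Sum>(a, b)\<in>?U \<union> ?L. q a b) = (\<Sum>(a, b)\<in>?U. q a b) + (\<Sum>(a, b)\<in>?L. q a b)"
    using fin by (intro sum.union_disjoint) auto
  also have "(\<Sum>(a, b)\<in>?L. q a b) = (\<Sum>(a, b)\<in>?U. q a b)"
    by (rule sum.reindex_bij_witness[of _ prod.swap prod.swap]) (auto simp: sym)
  finally show ?thesis by simp
qed

lemma expectation_unif_perm_sum:
  fixes f :: "'a \<Rightarrow> real"
  assumes S: "finite S" and T: "T \<subseteq> S"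
  shows "measure_pmf.expectation (unif_perm S) (\<lambda>\<sigma>. \<Sum>a\<in>T. f (\<sigma> a))
       = card T / card S * (\<Sum>a\<in>S. f a)"
proof -
  have "measure_pmf.expectation (unif_perm S) (\<lambda>\<sigma>. f (\<sigma> a)) = (\<Sum>a\<in>S. f a) / card S"
    if "a \<in> T" for a
  proof -
    have "a \<in> S" using that T by blast
    moreover from this S have "card S \<noteq> 0" by auto
    ultimately show ?thesis
      using expectation_unif_perm_at[OF S, of a f] by (simp add: field_simps)
  qed
  then show ?thesis
    by (simp add: integrable_unif_perm[OF S])
qed

text \<open>The diagonal terms follow the law of one position, the others the law of two distinct
  positions. If \<open>S\<close> is a singleton, the off-diagonal sum is empty and the division by
  zero is harmless.\<close>

lemma expectation_unif_perm_sum2: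
  fixes q :: "'a \<Rightarrow> 'a \<Rightarrow> real"
  assumes S: "finite S" and T: "T \<subseteq> S"
  shows "measure_pmf.expectation (unif_perm S) (\<lambda>\<sigma>. \<Sum>a\<in>T. \<Sum>b\<in>T. q (\<sigma> a) (\<sigma> b))
       = card T / card S * ((\<Sum>a\<in>S. q a a)
         + (real (card T) - 1) / (real (card S) - 1) * (\<Sum>a\<in>S. \<Sum>b\<in>S - {a}. q a b))"
proof -
  let ?E = "measure_pmf.expectation (unif_perm S)"
  let ?O = "\<Sum>a\<in>S. \<Sum>b\<in>S - {a}. q a b"
  have finT: "finite T" using S T finite_subset by blast
  have off: "?E (\<lambda>\<sigma>. q (\<sigma> a) (\<sigma> b)) = ?O / (card S * (real (card S) - 1))"
    if ab: "a \<in> T" "b \<in> T - {a}" for a b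
  proof -
    \<comment> \<open>Two distinct positions force \<open>card S\<close> to be at least 2, so both
      factors of the denominator are nonzero.\<close>
    have "card {a, b} \<le> card S" using ab T S by (intro card_mono) auto
    then have "card S \<ge> 2" using ab by (simp add: card_insert_if split: if_splits)
    then show ?thesis
      using expectation_unif_perm_at2[OF S, of a b q] ab T
      by (auto simp: field_simps of_nat_diff)
  qed
  have "?E (\<lambda>\<sigma>. \<Sum>a\<in>T. \<Sum>b\<in>T. q (\<sigma> a) (\<sigma> b))
      = ?E (\<lambda>\<sigma>. \<Sum>a\<in>T. q (\<sigma> a) (\<sigma> a)) + (\<Sum>a\<in>T. \<Sum>b\<in>T - {a}. ?E (\<lambda>\<sigma>. q (\<sigma> a) (\<sigma> b)))"
    by (simp add: integrable_unif_perm[OF S] sum_diag_offdiag[OF finT])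
  also have "(\<Sum>a\<in>T. \<Sum>b\<in>T - {a}. ?E (\<lambda>\<sigma>. q (\<sigma> a) (\<sigma> b)))
      = (\<Sum>a\<in>T. \<Sum>b\<in>T - {a}. ?O / (card S * (real (card S) - 1)))"
    by (intro sum.cong refl off)
  \<comment> \<open>Each inner sum has \<open>card T - 1\<close> terms. For empty \<open>T\<close>
    the natural and the real difference disagree, but the factor \<open>card T\<close>
    vanishes.\<close>
  also have "\<dots> = card T * (real (card T) - 1) * (?O / (card S * (real (card S) - 1)))"
    using finT by (cases "card T") auto
  finally show ?thesis
    by (simp add: expectation_unif_perm_sum[OF S T, of "\<lambda>a. q a a"] distrib_left)
qed

section \<open>The Frobenius inner product\<close>

definition frob_inner :: "real mat \<Rightarrow> real mat \<Rightarrow> real" where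
  "frob_inner M N = (\<Sum>i<dim_row M. \<Sum>j<dim_col M. M $$ (i, j) * N $$ (i, j))"

lemma frob_norm_sq: "(frob_norm M)\<^sup>2 = frob_inner M M"
  unfolding frob_norm_def frob_inner_def
  by (subst real_sqrt_pow2) (auto intro!: sum_nonneg simp: power2_eq_square)

lemma frob_inner_commute:
  assumes "M \<in> carrier_mat nr nc" "N \<in> carrier_mat nr nc"
  shows "frob_inner M N = frob_inner N M"
  using assms by (auto simp: frob_inner_def mult.commute)

lemma mat_trace_transpose_mult:
  assumes "M \<in> carrier_mat nr nc" "N \<in> carrier_mat nr nc"
  shows "mat_trace (transpose_mat M * N) = frob_inner M N"
  using assms
  by (auto simp: mat_trace_def frob_inner_def scalar_prod_def atLeast0LessThan
      intro: sum.swap[THEN trans])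

lemma frob_norm_diff_smult_sq:
  assumes "M \<in> carrier_mat nr nc" "N \<in> carrier_mat nr nc"
  shows "(frob_norm (M - \<beta> \<cdot>\<^sub>m N))\<^sup>2
       = frob_inner M M - 2 * \<beta> * frob_inner M N + \<beta>\<^sup>2 * frob_inner N N"
  unfolding frob_norm_sq using assms
  by (simp add: frob_inner_def sum_distrib_left power2_eq_square algebra_simps
      flip: sum.distrib sum_subtractf)

text \<open>Bilinearity for finite families: it reduces the inner products of \<open>C\<close> and
  \<open>C\<^sub>l\<close> to those of single block products.\<close>

lemma frob_inner_finsum_mat:
  assumes F: "finite F" and G: "finite G"
    and M: "M \<in> F \<rightarrow> carrier_mat nr nc" and N: "N \<in> G \<rightarrow> carrier_mat nr nc"
  shows "frob_inner (finsum_mat TYPE(real) nr nc M F) (finsum_mat TYPE(real) nr nc N G)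
       = (\<Sum>a\<in>F. \<Sum>b\<in>G. frob_inner (M a) (N b))"
proof -
  have "frob_inner (finsum_mat TYPE(real) nr nc M F) (finsum_mat TYPE(real) nr nc N G)
      = (\<Sum>i<nr. \<Sum>j<nc. \<Sum>a\<in>F. \<Sum>b\<in>G. M a $$ (i, j) * N b $$ (i, j))"
    using finsum_mat_closed[OF M]
    by (simp add: frob_inner_def index_finsum_mat[OF F _ _ M] index_finsum_mat[OF G _ _ N]
        sum_product)
  also have "\<dots> = (\<Sum>i<nr. \<Sum>a\<in>F. \<Sum>b\<in>G. \<Sum>j<nc. M a $$ (i, j) * N b $$ (i, j))"
    by (simp add: sum.swap[of _ _ "{..<nc}"])
  also have "\<dots> = (\<Sum>a\<in>F. \<Sum>b\<in>G. \<Sum>i<nr. \<Sum>j<nc. M a $$ (i, j) * N b $$ (i, j))"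
    by (simp add: sum.swap[of _ _ "{..<nr}"])
  also have "\<dots> = (\<Sum>a\<in>F. \<Sum>b\<in>G. frob_inner (M a) (N b))"
    using M by (intro sum.cong refl) (auto simp: frob_inner_def Pi_iff)
  finally show ?thesis .
qed

section \<open>The optimal scaling\<close>

text \<open>Completing the square leaves the excess \<open>c * (\<beta> - b / c)\<^sup>2\<close>
  over the value at \<open>b / c\<close>, which gives both existence and uniqueness of the
  minimiser.\<close>

lemma is_arg_min_quadratic:
  fixes s b c :: real
  assumes "c > 0"
  shows "{\<beta>. is_arg_min (\<lambda>\<beta>. s - 2 * \<beta> * b + \<beta>\<^sup>2 * c) (\<lambda>_. True) \<beta>} = {b / c}"
proof -
  let ?f = "\<lambda>\<beta>. s - 2 * \<beta> * b + \<beta>\<^sup>2 * c"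
  have f: "?f \<beta> = ?f (b / c) + c * (\<beta> - b / c)\<^sup>2" for \<beta>
    using assms by (simp add: power2_eq_square field_simps)
  have "?f (b / c) \<le> ?f \<beta>" for \<beta>
    using f[of \<beta>] assms by (metis le_add_same_cancel1 less_imp_le mult_nonneg_nonneg zero_le_power2)
  moreover have "?f (b / c) < ?f \<beta>" if "\<beta> \<noteq> b / c" for \<beta>
  proof -
    have "c * (\<beta> - b / c)\<^sup>2 > 0" using assms that by simp
    then show ?thesis using f[of \<beta>] by linarith
  qed
  ultimately have "is_arg_min ?f (\<lambda>_. True) \<beta> \<longleftrightarrow> \<beta> = b / c" for \<beta>
    unfolding is_arg_min_def by (metis not_less)
  then show ?thesis by simp
qed

theorem theorem1:
  fixes Nx Ny Nz K m :: nat
    and A B C :: "real mat"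
    and P :: "nat \<Rightarrow> real mat"
    and C\<^sub>l :: "(nat \<Rightarrow> nat) \<Rightarrow> real mat"
    and M\<^sub>1 M\<^sub>2 :: real
  assumes "Nx > 0" and "Ny > 0" and "Nz > 0"
    and "K \<ge> 2" and "K dvd Nz"
    and "A \<in> carrier_mat Nx Nz" and "B \<in> carrier_mat Nz Ny"
    and "m \<in> {1..K}"
  defines "C \<equiv> A * B"
    and "P \<equiv> \<lambda>k. col_block K A k * row_block K B k"
  defines "C\<^sub>l \<equiv> \<lambda>\<sigma>. finsum_mat TYPE(real) Nx Ny (\<lambda>k. P (\<sigma> k)) {1..m}"
    and "M\<^sub>1 \<equiv> \<Sum>i=1..K. (frob_norm (P i))\<^sup>2"
    and "M\<^sub>2 \<equiv> \<Sum>(i, j)\<in>{(i, j). 1 \<le> i \<and> i < j \<and> j \<le> K}. mat_trace (transpose_mat (P i) * P j)"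
  assumes "M\<^sub>1 + 2 * ((real m - 1) / (real K - 1)) * M\<^sub>2 \<noteq> 0"
  shows "{\<beta>. is_arg_min
            (\<lambda>\<beta>. measure_pmf.expectation (pmf_of_set {\<sigma>. \<sigma> permutes {1..K}})
                  (\<lambda>\<sigma>. (frob_norm (C - \<beta> \<cdot>\<^sub>m C\<^sub>l \<sigma>))\<^sup>2))
            (\<lambda>_. True) \<beta>}
       = {(M\<^sub>1 + 2 * M\<^sub>2) / (M\<^sub>1 + 2 * ((real m - 1) / (real K - 1)) * M\<^sub>2)}"
proof -
  let ?S = "{1..K}" and ?E = "measure_pmf.expectation (unif_perm {1..K})"
  \<comment> \<open>Keeps the simplifier from turning the lower bound of \<open>{1..K}\<close> into
    \<open>Suc 0\<close>.\<close>
  note One_nat_def [simp del]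
  define q where "q a b = frob_inner (P a) (P b)" for a b
  define D where "D = M\<^sub>1 + 2 * ((real m - 1) / (real K - 1)) * M\<^sub>2"
  have P: "P k \<in> carrier_mat Nx Ny" for k
    using assms(6,7) by (auto simp: P_def col_block_def row_block_def Let_def)
  have C: "C = finsum_mat TYPE(real) Nx Ny P ?S"
    unfolding C_def P_def using assms(5-7) by (intro mult_eq_finsum_mat_blocks)
  have Cc: "C \<in> carrier_mat Nx Ny" using assms(6,7) by (simp add: C_def)
  have Clc: "C\<^sub>l \<sigma> \<in> carrier_mat Nx Ny" for \<sigma>
    unfolding C\<^sub>l_def by (rule finsum_mat_closed) (use P in auto)
  have T: "{1..m} \<subseteq> ?S" using assms(8) by auto
  have sym: "q a b = q b a" for a b
    unfolding q_def by (rule frob_inner_commute[OF P P])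
  have M1: "M\<^sub>1 = (\<Sum>a\<in>?S. q a a)" by (simp add: M\<^sub>1_def q_def frob_norm_sq)
  have "{(i, j). 1 \<le> i \<and> i < j \<and> j \<le> K} = {(a, b). a \<in> ?S \<and> b \<in> ?S \<and> a < b}"
    by auto
  then have "M\<^sub>2 = (\<Sum>(a, b)\<in>{(a, b). a \<in> ?S \<and> b \<in> ?S \<and> a < b}. q a b)"
    unfolding M\<^sub>2_def mat_trace_transpose_mult[OF P P] q_def by (rule arg_cong)
  then have M2: "(\<Sum>a\<in>?S. \<Sum>b\<in>?S - {a}. q a b) = 2 * M\<^sub>2"
    by (simp only: sum_offdiag_symmetric[of ?S q, OF finite_atLeastAtMost sym])
  have tot: "(\<Sum>a\<in>?S. \<Sum>b\<in>?S. q a b) = M\<^sub>1 + 2 * M\<^sub>2"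
    by (simp only: sum_diag_offdiag[OF finite_atLeastAtMost] M1 M2)
  have CC: "frob_inner C C = M\<^sub>1 + 2 * M\<^sub>2"
    unfolding C using P by (subst frob_inner_finsum_mat) (auto simp: tot simp flip: q_def)
  \<comment> \<open>With the positions \<open>b\<close> outermost, this is a sum of one function
    evaluated at \<open>\<sigma> b\<close>, the shape needed for the law of one position.\<close>
  have "frob_inner C (C\<^sub>l \<sigma>) = (\<Sum>b\<in>{1..m}. \<Sum>a\<in>?S. q a (\<sigma> b))" for \<sigma>
    unfolding C C\<^sub>l_def using P
    by (subst frob_inner_finsum_mat) (auto simp flip: q_def intro: sum.swap)
  then have ECCl: "?E (\<lambda>\<sigma>. frob_inner C (C\<^sub>l \<sigma>)) = m / K * (M\<^sub>1 + 2 * M\<^sub>2)"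
    using expectation_unif_perm_sum[OF _ T, of "\<lambda>b. \<Sum>a\<in>?S. q a b"]
    by (simp add: sum.swap[of "\<lambda>b a. q a b"] tot)
  have "frob_inner (C\<^sub>l \<sigma>) (C\<^sub>l \<sigma>) = (\<Sum>a\<in>{1..m}. \<Sum>b\<in>{1..m}. q (\<sigma> a) (\<sigma> b))" for \<sigma>
    unfolding C\<^sub>l_def using P by (subst frob_inner_finsum_mat) (auto simp flip: q_def)
  then have EClCl: "?E (\<lambda>\<sigma>. frob_inner (C\<^sub>l \<sigma>) (C\<^sub>l \<sigma>)) = m / K * D"
    using expectation_unif_perm_sum2[OF _ T, of q] by (simp add: M1 M2 D_def)
  have mK: "real m / real K > 0" using assms(4,8) by auto
  have "?E (\<lambda>\<sigma>. frob_inner (C\<^sub>l \<sigma>) (C\<^sub>l \<sigma>)) \<ge> 0"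
    by (intro integral_nonneg_AE) (simp flip: frob_norm_sq)
  then have D: "D > 0"
    using mK assms(14) unfolding EClCl D_def[symmetric]
    by (simp add: zero_le_mult_iff del: times_divide_eq_left)
  have "?E (\<lambda>\<sigma>. (frob_norm (C - \<beta> \<cdot>\<^sub>m C\<^sub>l \<sigma>))\<^sup>2)
      = (M\<^sub>1 + 2 * M\<^sub>2) - 2 * \<beta> * (m / K * (M\<^sub>1 + 2 * M\<^sub>2)) + \<beta>\<^sup>2 * (m / K * D)" for \<beta>
    unfolding frob_norm_diff_smult_sq[OF Cc Clc]
    by (simp add: integrable_unif_perm ECCl EClCl CC)
  \<comment> \<open>The common factor \<open>m / K\<close> is positive, so it cancels from the
    vertex of the parabola.\<close>
  moreover have "m / K * (M\<^sub>1 + 2 * M\<^sub>2) / (m / K * D) = (M\<^sub>1 + 2 * M\<^sub>2) / D"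
    using mK by auto
  moreover have "m / K * D > 0" using mK D by (rule mult_pos_pos)
  ultimately show ?thesis
    using is_arg_min_quadratic[of "m / K * D" "M\<^sub>1 + 2 * M\<^sub>2" "m / K * (M\<^sub>1 + 2 * M\<^sub>2)"]
    unfolding D_def[symmetric] by simp
qed

end
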